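(* For every integer $n\geq 8$ there exists a $2$-strong non-Hamiltonian digraph of order $n$ in which $n-1$ of the vertices have degree at least $n$.
   Context: All digraphs are finite, without loops and without multiple arcs (opposite arcs $xy$ and $yx$ may both be present). For a vertex $x$, $d(x)=d^+(x)+d^-(x)$. A digraph $D$ is $k$-strong if $|V(D)|\geq k+1$ and $D-A$ is strongly connected for every set $A$ of at most $k-1$ vertices. A digraph is Hamiltonian if it contains a directed cycle through all its vertices. *)

theory Defs
  imports "Graph_Theory.Graph_Theory"
begin

definition total_degree :: "('a, 'b) pre_digraph \<Rightarrow> 'a \<Rightarrow> nat" where
  "total_degree G v = out_degree G v + in_degree G v"

text \<open>
  The bound ``at most \<open>k - 1\<close> vertices'' is written as \<open>card A < k\<close> to avoid truncated
  subtraction. The intended use is on finite digraphs, where \<open>card A\<close> is meaningful for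
  every set \<open>A\<close> of vertices.
\<close>

definition k_strong :: "nat \<Rightarrow> ('a, 'b) pre_digraph \<Rightarrow> bool" where
  "k_strong k G \<longleftrightarrow> k + 1 \<le> card (verts G) \<and>
     (\<forall>A \<subseteq> verts G. card A < k \<longrightarrow> strongly_connected (G \<restriction> (verts G - A)))"

text \<open>
  A cycle is a list of arcs, and every vertex on it is the tail of one of its arcs.
\<close>

definition hamiltonian :: "('a, 'b) pre_digraph \<Rightarrow> bool" where
  "hamiltonian G \<longleftrightarrow> (\<exists>p. pre_digraph.cycle G p \<and> tail G ` set p = verts G)"

end

theory Submission
  imports Defs
begin

text \<open>
  The digraph has a vertex \<open>0\<close> with out-neighbours \<open>2, 3\<close> and in-neighbours \<open>1, 3\<close>.
  Every vertex \<open>\<ge> 5\<close> can be left only towards \<open>2\<close>, \<open>4\<close> or another vertex \<open>\<ge> 5\<close>, while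
  \<open>{5, 6, 7}\<close> can be entered only from \<open>1\<close> and \<open>4\<close>, and \<open>1\<close> only from \<open>3\<close> and \<open>4\<close>; all arcs
  compatible with these rules are present.
  The successor map of a Hamiltonian cycle leaves no proper nonempty set of vertices
  invariant, but each choice of the two neighbours of \<open>0\<close> on the cycle produces such a set
  or leaves no way to enter \<open>{5, 6, 7}\<close>.
\<close>

section \<open>Hamiltonian cycles as cyclic permutations of the vertices\<close>

lemma (in pre_digraph) cas_closed_set:
  assumes "cas x p y" and "\<And>e. e \<in> set p \<Longrightarrow> tail G e \<in> S \<Longrightarrow> head G e \<in> S"
    and "x \<in> S \<or> (\<exists>e\<in>set p. tail G e \<in> S)"
  shows "y \<in> S"
  using assms by (induction p arbitrary: x) auto

text \<open>Companion of \<open>cas_closed_set\<close>: on a closed walk, that lemma carries any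
  visit to \<open>S\<close> forward to the base point, and this one then carries membership from the
  base point once around the walk.\<close>

lemma (in pre_digraph) cas_tail_closed_set:
  assumes "cas x p y" and "\<And>e. e \<in> set p \<Longrightarrow> tail G e \<in> S \<Longrightarrow> head G e \<in> S" and "x \<in> S"
  shows "tail G ` set p \<subseteq> S"
  using assms by (induction p arbitrary: x) auto

text \<open>The definition of a cycle asks for \<open>tl (awalk_verts u p)\<close> to be distinct;
  seen as the list of heads, this says that no two arcs of the cycle share a head.\<close>

lemma (in pre_digraph) cas_heads:
  "cas x p y \<Longrightarrow> map (head G) p = tl (awalk_verts x p)"
proof (induction p arbitrary: x)
  case (Cons e p)
  then show ?case by (cases p) auto
qed simp

lemma (in pre_digraph) cas_heads_tails:
  "cas x p y \<Longrightarrow> insert x (head G ` set p) = insert y (tail G ` set p)"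
  by (induction p arbitrary: x) auto

lemma (in pre_digraph) cas_last_head:
  "cas x p y \<Longrightarrow> p \<noteq> [] \<Longrightarrow> y = head G (last p)"
proof (induction p arbitrary: x)
  case (Cons e p)
  then show ?case by (cases p) auto
qed simp

text \<open>Each vertex is the tail of one arc of the cycle and the head of one, so following the
  arcs permutes the vertices. The last property says that this permutation has a single
  orbit.\<close>

lemma (in fin_digraph) hamiltonian_successor:
  assumes "hamiltonian G"
  obtains s where "bij_betw s (verts G) (verts G)"
    and "\<And>v. v \<in> verts G \<Longrightarrow> v \<rightarrow> s v"
    and "\<And>S. S \<subseteq> verts G \<Longrightarrow> S \<noteq> {} \<Longrightarrow> s ` S \<subseteq> S \<Longrightarrow> S = verts G"
proof -
  obtain p u where p: "awalk u p u" "distinct (tl (awalk_verts u p))" "p \<noteq> []"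
    and tails: "tail G ` set p = verts G"
    using assms unfolding hamiltonian_def cycle_def by blast
  have cas: "cas u p u" and arcs: "set p \<subseteq> arcs G" using p(1) by (auto simp: awalk_def)
  have "distinct (map (head G) p)" using cas_heads[OF cas] p(2) by simp
  then have inj_head: "inj_on (head G) (set p)" by (simp add: distinct_map)
  have "u \<in> tail G ` set p" using cas p(3) by (cases p) auto
  moreover have "u \<in> head G ` set p" using cas_last_head[OF cas p(3)] p(3) by auto
  ultimately have heads: "head G ` set p = verts G"
    using cas_heads_tails[OF cas] tails by (metis insert_absorb)
  \<comment> \<open>Heads map \<open>set p\<close> bijectively onto the vertices, so the two sets
    have equal size, and the surjection given by the tails is injective too.\<close>
  have inj_tail: "inj_on (tail G) (set p)"
    using inj_head heads tails by (metis List.finite_set card_image eq_card_imp_inj_on)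
  define s where "s = (\<lambda>v. head G (inv_into (set p) (tail G) v))"
  have s_tail: "s (tail G e) = head G e" if "e \<in> set p" for e
    using inj_tail that by (simp add: s_def)
  have bij: "bij_betw s (verts G) (verts G)"
    unfolding bij_betw_def
  proof
    show "inj_on s (verts G)"
    proof (rule inj_onI)
      fix v w assume "v \<in> verts G" "w \<in> verts G" and eq: "s v = s w"
      then obtain e f where "e \<in> set p" "f \<in> set p" "v = tail G e" "w = tail G f"
        using tails by (metis imageE)
      then show "v = w" using eq inj_head s_tail by (metis inj_onD)
    qed
    have "s ` tail G ` set p = head G ` set p" using s_tail by (simp add: image_image)
    then show "s ` verts G = verts G" using heads tails by simp
  qed
  have adj: "(v, s v) \<in> arcs_ends G" if "v \<in> verts G" for v
  proof -
    have "v \<in> tail G ` set p" using that tails by simp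
    then obtain e where e: "e \<in> set p" "v = tail G e" by (elim imageE)
    then have "(v, s v) = arc_to_ends G e" using s_tail by (simp add: arc_to_ends_def)
    moreover have "e \<in> arcs G" using e(1) arcs by (rule rev_subsetD)
    ultimately show ?thesis unfolding arcs_ends_def by (rule image_eqI)
  qed
  have closed: "S = verts G" if S: "S \<subseteq> verts G" "S \<noteq> {}" "s ` S \<subseteq> S" for S
  proof -
    have step: "head G e \<in> S" if "e \<in> set p" "tail G e \<in> S" for e
      using that S(3) s_tail by (metis image_subset_iff)
    obtain w where "w \<in> S" "w \<in> tail G ` set p" using S(1,2) tails by auto
    then have "\<exists>e\<in>set p. tail G e \<in> S" by (elim imageE) metis
    then have "u \<in> S" using cas_closed_set[OF cas step] by blast
    then have "verts G \<subseteq> S" using cas_tail_closed_set[OF cas step] tails by simp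
    with S(1) show ?thesis by blast
  qed
  show ?thesis using that[OF bij adj closed] .
qed

lemma (in wf_digraph) strongly_connected_hubI:
  assumes "h \<in> verts G"
    and "\<And>v. v \<in> verts G \<Longrightarrow> v \<rightarrow>\<^sup>* h" and "\<And>v. v \<in> verts G \<Longrightarrow> h \<rightarrow>\<^sup>* v"
  shows "strongly_connected G"
  using assms unfolding strongly_connected_def by (blast intro: reachable_trans)

section \<open>The example digraph\<close>

text \<open>The clauses only forbid arcs; everything else is allowed, which keeps the degrees high.
  Vertex \<open>0\<close> has degree 4 and is the one exception to the degree bound.\<close>

definition ex_arc :: "nat \<Rightarrow> nat \<Rightarrow> nat \<Rightarrow> bool" where
  "ex_arc n i j \<longleftrightarrow> i < n \<and> j < n \<and> i \<noteq> j \<and>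
     (i = 0 \<longrightarrow> j \<in> {2, 3}) \<and> (j = 0 \<longrightarrow> i \<in> {1, 3}) \<and>
     (j = 1 \<longrightarrow> i \<in> {3, 4}) \<and> (j \<in> {5, 6, 7} \<longrightarrow> i \<in> {1, 4, 5, 6, 7}) \<and>
     (5 \<le> i \<longrightarrow> 5 \<le> j \<or> j \<in> {2, 4})"

lemma ex_arc_basic: "ex_arc n i j \<Longrightarrow> i < n \<and> j < n \<and> i \<noteq> j"
  by (simp add: ex_arc_def)

definition ex_digraph :: "nat \<Rightarrow> (nat, nat \<times> nat) pre_digraph" where
  "ex_digraph n = \<lparr>verts = {..<n}, arcs = {(i, j). ex_arc n i j}, tail = fst, head = snd\<rparr>"

lemma ex_digraph_simps [simp]:
  "verts (ex_digraph n) = {..<n}" "arcs (ex_digraph n) = {(i, j). ex_arc n i j}"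
  "tail (ex_digraph n) = fst" "head (ex_digraph n) = snd"
  by (simp_all add: ex_digraph_def)

lemma dominates_ex_digraph [simp]: "i \<rightarrow>\<^bsub>ex_digraph n\<^esub> j \<longleftrightarrow> ex_arc n i j"
  by (force simp: arcs_ends_conv)

lemma digraph_ex_digraph: "digraph (ex_digraph n)"
proof
  have "arcs (ex_digraph n) \<subseteq> {..<n} \<times> {..<n}" by (auto dest: ex_arc_basic)
  then show "finite (arcs (ex_digraph n))" by (rule finite_subset) simp
qed (auto dest: ex_arc_basic simp: arc_to_ends_def)

section \<open>Degrees in the example\<close>

lemma total_degree_ex_digraph_ge:
  assumes "\<And>j. j \<in> X \<Longrightarrow> ex_arc n v j" and "\<And>i. i \<in> Y \<Longrightarrow> ex_arc n i v"
    and "m \<le> card X + card Y"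
  shows "m \<le> total_degree (ex_digraph n) v"
proof -
  interpret digraph "ex_digraph n" by (rule digraph_ex_digraph)
  have "card X = card (Pair v ` X)" by (simp add: card_image inj_on_def)
  also have "\<dots> \<le> out_degree (ex_digraph n) v"
    unfolding out_degree_def using assms(1) by (intro card_mono finite_out_arcs) (auto simp: out_arcs_def)
  finally have X: "card X \<le> out_degree (ex_digraph n) v" .
  have "card Y = card ((\<lambda>i. (i, v)) ` Y)" by (simp add: card_image inj_on_def)
  also have "\<dots> \<le> in_degree (ex_digraph n) v"
    unfolding in_degree_def using assms(2) by (intro card_mono finite_in_arcs) (auto simp: in_arcs_def)
  finally show ?thesis using X assms(3) by (simp add: total_degree_def)
qed

text \<open>Out-neighbours plus in-neighbours number n+1, 2n-7, n, 2n-4, n and 2n-9 in the six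
  cases. In the last one, \<open>8 \<le> v\<close> and \<open>v < n\<close> give n \<ge> 9, hence
  2n-9 \<ge> n.\<close>

lemma total_degree_ex_digraph:
  assumes n: "8 \<le> n" and v: "v \<in> {1..<n}"
  shows "n \<le> total_degree (ex_digraph n) v"
proof -
  have card: "card ({..<n} - F) = n - card F" if "F \<subseteq> {..<n}" for F
    using that by (simp add: card_Diff_subset finite_subset[OF that])
  consider "v = 1" | "v = 2" | "v = 3" | "v = 4" | "v \<in> {5, 6, 7}" | "8 \<le> v"
    using v by force
  then show ?thesis
  proof cases
    case 1
    then show ?thesis
      using n by (intro total_degree_ex_digraph_ge[of "{..<n} - {1}" _ _ "{3, 4}"]) (auto simp: card ex_arc_def)
  next
    case 2
    then show ?thesis
      using n by (intro total_degree_ex_digraph_ge[of "{..<n} - {0, 1, 2, 5, 6, 7}" _ _ "{..<n} - {2}"]) (auto simp: card ex_arc_def)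
  next
    case 3
    then show ?thesis
      using n by (intro total_degree_ex_digraph_ge[of "{..<n} - {3, 5, 6, 7}" _ _ "{0, 1, 2, 4}"]) (auto simp: card ex_arc_def)
  next
    case 4
    then show ?thesis
      using n by (intro total_degree_ex_digraph_ge[of "{..<n} - {0, 4}" _ _ "{..<n} - {0, 4}"]) (auto simp: card ex_arc_def)
  next
    \<comment> \<open>Four vertices are not out-neighbours: \<open>0\<close>, \<open>1\<close>,
      \<open>3\<close> and \<open>v\<close> itself. The four in-neighbours \<open>1\<close>,
      \<open>4\<close> and the other two of \<open>{5, 6, 7}\<close> exactly make up for
      them.\<close>
    case 5
    then show ?thesis
      using n by (intro total_degree_ex_digraph_ge[of "{..<n} - {0, 1, 3, v}" _ _ "{1, 4, 5, 6, 7} - {v}"]) (auto simp: card ex_arc_def)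
  next
    case 6
    then show ?thesis
      using n v by (intro total_degree_ex_digraph_ge[of "{..<n} - {0, 1, 3, 5, 6, 7, v}" _ _ "{..<n} - {0, v}"]) (auto simp: card ex_arc_def)
  qed
qed

section \<open>The example is 2-strong\<close>

text \<open>At most one vertex is deleted. Vertex \<open>4\<close> is joined in both directions to
  every vertex except \<open>0\<close>, and \<open>0\<close> keeps an out-neighbour and an
  in-neighbour because it has two of each; so \<open>4\<close> serves as a hub unless it is the
  deleted vertex. In that case \<open>3\<close> is the hub.\<close>

lemma k_strong_ex_digraph:
  assumes n: "8 \<le> n"
  shows "k_strong 2 (ex_digraph n)"
  unfolding k_strong_def
proof (intro conjI allI impI)
  show "2 + 1 \<le> card (verts (ex_digraph n))" using n by simp
  fix A assume A: "A \<subseteq> verts (ex_digraph n)" "card A < 2"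
  define V where "V = {..<n} - A"
  define H where "H = ex_digraph n \<restriction> V"
  interpret D: digraph "ex_digraph n" by (rule digraph_ex_digraph)
  interpret H: wf_digraph H unfolding H_def V_def by (rule D.wellformed_induce_subgraph)
  have V: "verts H = V" by (simp add: H_def)
  have arc: "x \<rightarrow>\<^bsub>H\<^esub> y" if "ex_arc n x y" "x \<in> V" "y \<in> V" for x y
    using that by (force simp: H_def arcs_ends_conv)
  note path = H.reachable_adjI[OF arc]
  have "finite A" using A(1) finite_subset by auto
  then have A1: "x = y" if "x \<in> A" "y \<in> A" for x y
    using A(2) that by (metis card_le_Suc0_iff_eq less_2_cases_iff less_Suc_eq_le numeral_2_eq_2)
  have "strongly_connected H"
  proof (cases "4 \<in> A")
    case False
    have hub: "4 \<in> V" using False n by (simp add: V_def)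
    have to: "x \<rightarrow>\<^sup>*\<^bsub>H\<^esub> 4" if "x \<in> V" "x \<noteq> 0" for x
      using that hub by (cases "x = 4") (auto simp: V ex_arc_def V_def intro!: path)
    have from': "4 \<rightarrow>\<^sup>*\<^bsub>H\<^esub> x" if "x \<in> V" "x \<noteq> 0" for x
      using that hub by (cases "x = 4") (auto simp: V ex_arc_def V_def intro!: path)
    have to0: "0 \<rightarrow>\<^sup>*\<^bsub>H\<^esub> 4" if "0 \<in> V"
    proof -
      have "2 \<in> V \<or> 3 \<in> V" using A1[of 2 3] n by (auto simp: V_def)
      then obtain y where y: "y \<in> V" "y \<noteq> 0" "ex_arc n 0 y" using n by (auto simp: ex_arc_def)
      then show ?thesis using path[OF y(3) that y(1)] to H.reachable_trans by blast
    qed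
    have from0: "4 \<rightarrow>\<^sup>*\<^bsub>H\<^esub> 0" if "0 \<in> V"
    proof -
      have "1 \<in> V \<or> 3 \<in> V" using A1[of 1 3] n by (auto simp: V_def)
      then obtain y where y: "y \<in> V" "y \<noteq> 0" "ex_arc n y 0" using n by (auto simp: ex_arc_def)
      then show ?thesis using path[OF y(3) y(1) that] from' H.reachable_trans by blast
    qed
    show ?thesis
      using hub to from' to0 from0 by (intro H.strongly_connected_hubI[of 4]) (auto simp: V)
  next
    case True
    then have V_iff: "x \<in> V \<longleftrightarrow> x < n \<and> x \<noteq> 4" for x using A1 by (auto simp: V_def)
    have low: "0 \<in> V" "1 \<in> V" "2 \<in> V" "3 \<in> V" using n by (auto simp: V_iff)
    show ?thesis
    proof (rule H.strongly_connected_hubI[of 3])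
      show "3 \<in> verts H" using low V by simp
      \<comment> \<open>Without \<open>4\<close>, the vertices below 4 have an arc to
        \<open>3\<close> (or are \<open>3\<close>), and those from 5 on pass through
        \<open>2\<close>. Conversely \<open>3\<close> has an arc to \<open>1\<close>, which
        dominates all other vertices.\<close>
      have low_to: "x \<rightarrow>\<^sup>*\<^bsub>H\<^esub> 3" if "x < 4" for x
        using that low V n by (cases "x = 3") (auto simp: V_iff ex_arc_def intro!: path)
      show "x \<rightarrow>\<^sup>*\<^bsub>H\<^esub> 3" if "x \<in> verts H" for x
      proof (cases "x < 4")
        case False
        then have "x \<rightarrow>\<^sup>*\<^bsub>H\<^esub> 2" using that n V by (intro path) (auto simp: V_iff ex_arc_def)
        then show ?thesis using low_to[of 2] by (auto intro: H.reachable_trans)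
      qed (rule low_to)
      have one: "3 \<rightarrow>\<^sup>*\<^bsub>H\<^esub> 1" using low n by (intro path) (auto simp: ex_arc_def)
      show "3 \<rightarrow>\<^sup>*\<^bsub>H\<^esub> x" if "x \<in> verts H" for x
      proof -
        have x: "x \<in> V" using that V by simp
        show ?thesis
        proof (cases "x = 1")
          case False
          then have "1 \<rightarrow>\<^sup>*\<^bsub>H\<^esub> x" using x low n by (intro path) (auto simp: V_iff ex_arc_def)
          then show ?thesis using one H.reachable_trans by blast
        qed (use one in simp)
      qed
    qed
  qed
  then show "strongly_connected (ex_digraph n \<restriction> (verts (ex_digraph n) - A))"
    by (simp add: H_def V_def)
qed

section \<open>The example is not Hamiltonian\<close>

lemma not_hamiltonian_ex_digraph:
  assumes n: "8 \<le> n"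
  shows "\<not> hamiltonian (ex_digraph n)"
proof
  assume ham: "hamiltonian (ex_digraph n)"
  interpret D: digraph "ex_digraph n" by (rule digraph_ex_digraph)
  obtain s where bij: "bij_betw s {..<n} {..<n}"
    and arc: "\<And>v. v < n \<Longrightarrow> ex_arc n v (s v)"
    and closed: "\<And>S. S \<subseteq> {..<n} \<Longrightarrow> S \<noteq> {} \<Longrightarrow> s ` S \<subseteq> S \<Longrightarrow> S = {..<n}"
    using D.hamiltonian_successor[OF ham]
    by (metis dominates_ex_digraph ex_digraph_simps(1) lessThan_iff)
  have inj: "i = j" if "s i = s j" "i < n" "j < n" for i j
    using bij that by (auto simp: bij_betw_def inj_on_def)
  have pred: "\<exists>i<n. s i = j" if "j < n" for j
    using bij that by (metis bij_betw_def imageE lessThan_iff)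
  \<comment> \<open>The single-orbit property as a contradiction: \<open>x\<close> witnesses that
    \<open>S\<close> is nonempty, \<open>y\<close> that it is proper.\<close>
  have no_closed: False if "x \<in> S" "y \<notin> S" "y < n" "S \<subseteq> {..<n}" "\<And>x. x \<in> S \<Longrightarrow> s x \<in> S" for x y S
    using closed[of S] that by blast
  let ?W = "{5..<n}"
  have W: "s x \<in> ?W \<or> s x \<in> {2, 4}" if "x \<in> ?W" for x
    using arc[of x] that by (auto simp: ex_arc_def)
  \<comment> \<open>Otherwise the complement of \<open>{5, 6, 7}\<close> would be invariant, since
    only \<open>1\<close> and \<open>4\<close> lead into that set from outside. The weaker
    conclusion about \<open>?W\<close> is what the cases below use.\<close>
  have enter: "s 1 \<in> ?W \<or> s 4 \<in> ?W"
  proof (rule ccontr)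
    assume contra: "\<not> ?thesis"
    have "s x \<in> {..<n} - {5, 6, 7}" if x: "x \<in> {..<n} - {5, 6, 7}" for x
    proof -
      have x_arc: "ex_arc n x (s x)" using arc x by simp
      then have less: "s x < n" by (simp add: ex_arc_def)
      have "s x \<notin> {5, 6, 7}"
      proof
        assume sx: "s x \<in> {5, 6, 7}"
        then have "x \<in> {1, 4, 5, 6, 7}" using x_arc unfolding ex_arc_def by blast
        then have "x = 1 \<or> x = 4" using x by simp
        moreover have "s x \<in> ?W" using sx less by auto
        ultimately show False using contra by metis
      qed
      with less show ?thesis by simp
    qed
    then show False by (rule no_closed[of 0 "{..<n} - {5, 6, 7}" 5, rotated -1]) (use n in auto)
  qed
  have s0: "s 0 = 2 \<or> s 0 = 3" using arc[of 0] n by (simp add: ex_arc_def)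
  obtain i where "i < n" "s i = 0" using pred[of 0] n by auto
  then have s_pred: "s 1 = 0 \<or> s 3 = 0" using arc[of i] unfolding ex_arc_def by fastforce
  obtain j where "j < n" "s j = 1" using pred[of 1] n by auto
  then have s1: "s 3 = 1 \<or> s 4 = 1" using arc[of j] unfolding ex_arc_def by fastforce
  consider (a) "s 0 = 3" "s 1 = 0" | (b) "s 0 = 2" "s 3 = 0"
    | (c) "s 0 = 2" "s 1 = 0" | (d) "s 0 = 3" "s 3 = 0"
    using s0 s_pred by metis
  then show False
  proof cases
    case a
    then have "s 4 \<noteq> 1" using enter by auto
    then have "s 3 = 1" using s1 by simp
    \<comment> \<open>The cycle would close early as 0 -> 3 -> 1 -> 0.\<close>
    then show False by (intro no_closed[of 0 "{0, 1, 3}" 2]) (use a n in auto)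
  next
    case b
    then have s4: "s 4 = 1" using s1 by auto
    then have "s 1 \<in> ?W" using enter by simp
    \<comment> \<open>\<open>2\<close> already follows \<open>0\<close>, so by injectivity
      \<open>?W\<close> can be left only through \<open>4\<close>. As \<open>4\<close> is followed
      by \<open>1\<close>, and \<open>1\<close> by a vertex of \<open>?W\<close>, the orbit never
      reaches \<open>0\<close>.\<close>
    moreover have "s x \<noteq> 2" if "x \<in> ?W" for x using inj[of x 0] b(1) that n by auto
    then have "s x \<in> insert 4 ?W" if "x \<in> ?W" for x using W[OF that] that by blast
    ultimately show False
      by (intro no_closed[of 4 "{1, 4} \<union> ?W" 0]) (use s4 n in auto)
  next
    case c
    then have "s 4 \<in> ?W" using enter by simp
    \<comment> \<open>Again \<open>4\<close> is the only exit from \<open>?W\<close>, and here it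
      leads straight back into \<open>?W\<close>.\<close>
    moreover have "s x \<noteq> 2" if "x \<in> ?W" for x using inj[of x 0] c(1) that n by auto
    then have "s x \<in> insert 4 ?W" if "x \<in> ?W" for x using W[OF that] that by blast
    ultimately show False
      by (intro no_closed[of 4 "insert 4 ?W" 0]) (use n in auto)
  next
    case d
    \<comment> \<open>The opposite arcs between \<open>0\<close> and \<open>3\<close> would form a
      2-cycle.\<close>
    then show False by (intro no_closed[of 0 "{0, 3}" 1]) (use n in auto)
  qed
qed

theorem theorem3p4:
  fixes n :: nat
  assumes "n \<ge> 8"
  shows "\<exists>D :: (nat, nat \<times> nat) pre_digraph.
           digraph D \<and> card (verts D) = n \<and> k_strong 2 D \<and> \<not> hamiltonian D \<and>
           (\<exists>S \<subseteq> verts D. card S = n - 1 \<and> (\<forall>v \<in> S. total_degree D v \<ge> n))"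
proof -
  have "\<exists>S \<subseteq> verts (ex_digraph n). card S = n - 1 \<and>
      (\<forall>v \<in> S. total_degree (ex_digraph n) v \<ge> n)"
    \<comment> \<open>All vertices except \<open>0\<close>.\<close>
    using assms total_degree_ex_digraph by (intro exI[of _ "{1..<n}"]) auto
  then show ?thesis
    using assms digraph_ex_digraph k_strong_ex_digraph not_hamiltonian_ex_digraph
    by (intro exI[of _ "ex_digraph n"]) simp
qed

end
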